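(* Let $M$ be a compact smooth manifold of dimension $m$ (regarded as a compact metric space), let $\mathfrak{B}_M$ be its Borel $\sigma$-algebra, and let $\mu$ be a probability measure on $(M,\mathfrak{B}_M)$. Let $T: M\to M$ be a smooth diffeomorphism that is measure-preserving, i.e. $\mu\circ T^{-1}=\mu$. Let $f: M\to\mathbb{R}$ be a smooth observable, $f\in L_2(M)=L_2(M,\mu)$, such that the delay map $$\mathit{\Phi}_{(T,f)}: M\to\mathbb{R}^{2m+1},\qquad \mathit{\Phi}_{(T,f)}(x)=\bigl(f(x),\,f(T(x)),\,\ldots,\,f(T^{2m}(x))\bigr)$$ is an embedding. Let $\varphi: M\to\varphi(M)=\mathit{\Phi}_{(T,f)}(M)\subseteq\mathbb{R}^{2m+1}$ be the homeomorphism onto the image given by $\mathit{\Phi}_{(T,f)}$, and let $\tilde{T}: \varphi(M)\to\varphi(M)$ be the reconstructed map, determined by $\varphi\circ T=\tilde{T}\circ\varphi$. Then the Koopman operators $\mathbf{U}_T: L_2(M)\to L_2(M)$ and $\mathbf{U}_{\tilde{T}}: L_2(\varphi(M))\to L_2(\varphi(M))$ are spectrally equivalent, where $L_2(\varphi(M))$ is taken with respect to the measure $\mu\circ\varphi^{-1}$.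
   Context: "Smooth" means at least $C^2$. An observable is a scalar-valued function on the state space. $L_2(M)$ is the Hilbert space of (complex) scalar-valued functions on $M$ whose squared absolute value is $\mu$-integrable, with inner product $(h_1,h_2)_{L_2(M)}=\int_M \overline{h_1}\,h_2\,d\mu$. $L_2(\varphi(M))$ is the corresponding space on $\varphi(M)$ with its Borel $\sigma$-algebra and the push-forward measure $\mu\circ\varphi^{-1}$, with inner product $(g_1,g_2)_{L_2(\varphi(M))}=\int_{\varphi(M)}\overline{g_1}\,g_2\,d(\mu\circ\varphi^{-1})$. As usual, functions are identified when equal almost everywhere. The Koopman operator of a map $S: X\to X$ acting on a space $\mathcal{F}_X$ of observables on $X$ is the composition operator $\mathbf{U}_S h=h\circ S$ for $h\in\mathcal{F}_X$. Here $\mathcal{F}_M=L_2(M)$ for $S=T$ and $\mathcal{F}_{\varphi(M)}=L_2(\varphi(M))$ for $S=\tilde{T}$. Two bounded operators $A: H_1\to H_1$ and $B: H_2\to H_2$ on Hilbert spaces are called spectrally equivalent if there is a unitary operator $W: H_2\to H_1$ (a linear surjection preserving inner products) such that $W\circ B=A\circ W$. *)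

theory Defs
  imports "HOL-Probability.Probability_Measure"
begin

section \<open>Smooth manifolds\<close>

text \<open>
  $\mathbb{R}^n$ is \<^term>\<open>Euclidean_space n\<close>: the sequences in \<^typ>\<open>nat \<Rightarrow> real\<close> that vanish
  from index \<open>n\<close> on.  This allows every dimension \<open>n \<ge> 0\<close>, and lets \<open>m\<close> and \<open>2 * m + 1\<close> occur
  in the same statement.
\<close>

definition partial_deriv :: "nat \<Rightarrow> ((nat \<Rightarrow> real) \<Rightarrow> real) \<Rightarrow> (nat \<Rightarrow> real) \<Rightarrow> real" where
  "partial_deriv i g x = deriv (\<lambda>t. g (x(i := t))) (x i)"

text \<open>
  \<open>C_k_on n k U g\<close>: all partial derivatives of \<open>g\<close> up to order \<open>k\<close> exist and are continuous on \<open>U\<close>.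
  It is meant for sets \<open>U\<close> that are open in \<^term>\<open>Euclidean_space n\<close>; then the values of \<open>g\<close>
  outside \<open>U\<close> are irrelevant.
\<close>

primrec C_k_on :: "nat \<Rightarrow> nat \<Rightarrow> (nat \<Rightarrow> real) set \<Rightarrow> ((nat \<Rightarrow> real) \<Rightarrow> real) \<Rightarrow> bool" where
  "C_k_on n 0 U g \<longleftrightarrow> continuous_on U g"
| "C_k_on n (Suc k) U g \<longleftrightarrow> continuous_on U g \<and>
     (\<forall>i<n. (\<forall>x\<in>U. (\<lambda>t. g (x(i := t))) differentiable at (x i)) \<and>
            C_k_on n k U (partial_deriv i g))"

text \<open>
  Smooth means at least $C^2$, and $C^k$ data with \<open>k \<ge> 2\<close> are in particular $C^2$ data.
\<close>

abbreviation smooth_on :: "nat \<Rightarrow> (nat \<Rightarrow> real) set \<Rightarrow> ((nat \<Rightarrow> real) \<Rightarrow> real) \<Rightarrow> bool" where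
  "smooth_on n U g \<equiv> C_k_on n 2 U g"

type_synonym 'a chart = "'a set \<times> ('a \<Rightarrow> nat \<Rightarrow> real)"

definition chart_on :: "nat \<Rightarrow> 'a::topological_space set \<Rightarrow> 'a chart \<Rightarrow> bool" where
  "chart_on m M = (\<lambda>(U, c).
     openin (top_of_set M) U \<and>
     openin (Euclidean_space m) (c ` U) \<and>
     homeomorphic_map (top_of_set U) (subtopology (Euclidean_space m) (c ` U)) c)"

definition smooth_map ::
  "nat \<Rightarrow> 'a::topological_space set \<Rightarrow> 'a chart set \<Rightarrow> ('a \<Rightarrow> 'a) \<Rightarrow> bool" where
  "smooth_map m M \<A> F \<longleftrightarrow>
     F ` M \<subseteq> M \<and> continuous_on M F \<and>
     (\<forall>(U, c)\<in>\<A>. \<forall>(V, d)\<in>\<A>. \<forall>j<m.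
        smooth_on m (c ` (U \<inter> F -` V)) (\<lambda>y. d (F (inv_into U c y)) j))"

text \<open>
  The Hausdorff property and second countability are automatic for compact subsets of a metric
  space.  For the identity map, the last conjunct of \<^const>\<open>smooth_map\<close> says that the
  transition maps between charts are smooth.
\<close>

definition compact_smooth_manifold ::
  "nat \<Rightarrow> 'a::metric_space set \<Rightarrow> 'a chart set \<Rightarrow> bool" where
  "compact_smooth_manifold m M \<A> \<longleftrightarrow>
     compact M \<and>
     (\<forall>C\<in>\<A>. chart_on m M C) \<and>
     \<Union> (fst ` \<A>) = M \<and>
     smooth_map m M \<A> (\<lambda>x. x)"

definition smooth_diffeo ::
  "nat \<Rightarrow> 'a::topological_space set \<Rightarrow> 'a chart set \<Rightarrow> ('a \<Rightarrow> 'a) \<Rightarrow> bool" where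
  "smooth_diffeo m M \<A> F \<longleftrightarrow>
     bij_betw F M M \<and> smooth_map m M \<A> F \<and> smooth_map m M \<A> (inv_into M F)"

definition smooth_observable :: "nat \<Rightarrow> 'a chart set \<Rightarrow> ('a \<Rightarrow> real) \<Rightarrow> bool" where
  "smooth_observable m \<A> g \<longleftrightarrow> (\<forall>(U, c)\<in>\<A>. smooth_on m (c ` U) (\<lambda>y. g (inv_into U c y)))"

text \<open>Injectivity of the differential: the Jacobian matrix in every chart has trivial kernel.\<close>

definition immersion :: "nat \<Rightarrow> 'a chart set \<Rightarrow> nat \<Rightarrow> ('a \<Rightarrow> nat \<Rightarrow> real) \<Rightarrow> bool" where
  "immersion m \<A> p F \<longleftrightarrow>
     (\<forall>(U, c)\<in>\<A>. \<forall>x\<in>U. \<forall>v :: nat \<Rightarrow> real.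
        (\<forall>j<p. (\<Sum>i<m. partial_deriv i (\<lambda>y. F (inv_into U c y) j) (c x) * v i) = 0) \<longrightarrow>
        (\<forall>i<m. v i = 0))"

definition smooth_embedding ::
  "nat \<Rightarrow> 'a::topological_space set \<Rightarrow> 'a chart set \<Rightarrow> nat \<Rightarrow> ('a \<Rightarrow> nat \<Rightarrow> real) \<Rightarrow> bool" where
  "smooth_embedding m M \<A> p F \<longleftrightarrow>
     embedding_map (top_of_set M) (Euclidean_space p) F \<and>
     (\<forall>j<p. smooth_observable m \<A> (\<lambda>x. F x j)) \<and>
     immersion m \<A> p F"

definition delay_map :: "nat \<Rightarrow> ('a \<Rightarrow> 'a) \<Rightarrow> ('a \<Rightarrow> real) \<Rightarrow> 'a \<Rightarrow> nat \<Rightarrow> real" where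
  "delay_map m T f x = (\<lambda>i. if i < 2 * m + 1 then f ((T ^^ i) x) else 0)"


section \<open>Hilbert spaces and spectral equivalence\<close>

record 'v hspace =
  hcarrier :: "'v set"
  hzero :: 'v
  hadd :: "'v \<Rightarrow> 'v \<Rightarrow> 'v"
  hscale :: "complex \<Rightarrow> 'v \<Rightarrow> 'v"
  hinner :: "'v \<Rightarrow> 'v \<Rightarrow> complex"

definition hnorm :: "'v hspace \<Rightarrow> 'v \<Rightarrow> real" where
  "hnorm H x = sqrt (Re (hinner H x x))"

definition hdist :: "'v hspace \<Rightarrow> 'v \<Rightarrow> 'v \<Rightarrow> real" where
  "hdist H x y = hnorm H (hadd H x (hscale H (-1) y))"

locale hilbert_space =
  fixes H :: "'v hspace"
  assumes zero_closed: "hzero H \<in> hcarrier H"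
    and add_closed: "\<lbrakk>x \<in> hcarrier H; y \<in> hcarrier H\<rbrakk> \<Longrightarrow> hadd H x y \<in> hcarrier H"
    and scale_closed: "x \<in> hcarrier H \<Longrightarrow> hscale H a x \<in> hcarrier H"
    and add_assoc: "\<lbrakk>x \<in> hcarrier H; y \<in> hcarrier H; z \<in> hcarrier H\<rbrakk> \<Longrightarrow>
      hadd H (hadd H x y) z = hadd H x (hadd H y z)"
    and add_commute: "\<lbrakk>x \<in> hcarrier H; y \<in> hcarrier H\<rbrakk> \<Longrightarrow> hadd H x y = hadd H y x"
    and add_zero: "x \<in> hcarrier H \<Longrightarrow> hadd H x (hzero H) = x"
    and add_uminus: "x \<in> hcarrier H \<Longrightarrow> hadd H x (hscale H (-1) x) = hzero H"
    and scale_add_right: "\<lbrakk>x \<in> hcarrier H; y \<in> hcarrier H\<rbrakk> \<Longrightarrow>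
      hscale H a (hadd H x y) = hadd H (hscale H a x) (hscale H a y)"
    and scale_add_left: "x \<in> hcarrier H \<Longrightarrow>
      hscale H (a + b) x = hadd H (hscale H a x) (hscale H b x)"
    and scale_scale: "x \<in> hcarrier H \<Longrightarrow> hscale H a (hscale H b x) = hscale H (a * b) x"
    and scale_one: "x \<in> hcarrier H \<Longrightarrow> hscale H 1 x = x"
    and inner_commute: "\<lbrakk>x \<in> hcarrier H; y \<in> hcarrier H\<rbrakk> \<Longrightarrow> hinner H x y = cnj (hinner H y x)"
    and inner_add_right: "\<lbrakk>x \<in> hcarrier H; y \<in> hcarrier H; z \<in> hcarrier H\<rbrakk> \<Longrightarrow>
      hinner H x (hadd H y z) = hinner H x y + hinner H x z"
    and inner_scale_right: "\<lbrakk>x \<in> hcarrier H; y \<in> hcarrier H\<rbrakk> \<Longrightarrow>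
      hinner H x (hscale H a y) = a * hinner H x y"
    and inner_nonneg: "x \<in> hcarrier H \<Longrightarrow> 0 \<le> Re (hinner H x x)"
    and inner_eq_zero: "\<lbrakk>x \<in> hcarrier H; hinner H x x = 0\<rbrakk> \<Longrightarrow> x = hzero H"
    and complete: "\<lbrakk>\<And>n. s n \<in> hcarrier H;
        \<forall>e>0. \<exists>N. \<forall>i\<ge>N. \<forall>j\<ge>N. hdist H (s i) (s j) < e\<rbrakk> \<Longrightarrow>
      \<exists>l\<in>hcarrier H. (\<lambda>n. hdist H (s n) l) \<longlonglongrightarrow> 0"

definition linear_operator :: "'v hspace \<Rightarrow> 'w hspace \<Rightarrow> ('v \<Rightarrow> 'w) \<Rightarrow> bool" where
  "linear_operator H K A \<longleftrightarrow>
     (\<forall>x\<in>hcarrier H. A x \<in> hcarrier K) \<and>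
     (\<forall>x\<in>hcarrier H. \<forall>y\<in>hcarrier H. A (hadd H x y) = hadd K (A x) (A y)) \<and>
     (\<forall>a. \<forall>x\<in>hcarrier H. A (hscale H a x) = hscale K a (A x))"

definition bounded_operator :: "'v hspace \<Rightarrow> ('v \<Rightarrow> 'v) \<Rightarrow> bool" where
  "bounded_operator H A \<longleftrightarrow>
     linear_operator H H A \<and> (\<exists>B. \<forall>x\<in>hcarrier H. hnorm H (A x) \<le> B * hnorm H x)"

definition unitary_operator :: "'v hspace \<Rightarrow> 'w hspace \<Rightarrow> ('v \<Rightarrow> 'w) \<Rightarrow> bool" where
  "unitary_operator H K W \<longleftrightarrow>
     linear_operator H K W \<and> W ` hcarrier H = hcarrier K \<and>
     (\<forall>x\<in>hcarrier H. \<forall>y\<in>hcarrier H. hinner K (W x) (W y) = hinner H x y)"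

text \<open>
  The standing requirement that \<open>A\<close> and \<open>B\<close> are bounded operators on Hilbert spaces is part of
  the definition.
\<close>

definition spectrally_equivalent ::
  "'v hspace \<Rightarrow> ('v \<Rightarrow> 'v) \<Rightarrow> 'w hspace \<Rightarrow> ('w \<Rightarrow> 'w) \<Rightarrow> bool" where
  "spectrally_equivalent H1 A H2 B \<longleftrightarrow>
     hilbert_space H1 \<and> bounded_operator H1 A \<and>
     hilbert_space H2 \<and> bounded_operator H2 B \<and>
     (\<exists>W. unitary_operator H2 H1 W \<and> (\<forall>x\<in>hcarrier H2. W (B x) = A (W x)))"


section \<open>The space of square-integrable functions and the Koopman operator\<close>

definition square_integrable :: "'a measure \<Rightarrow> ('a \<Rightarrow> complex) set" where
  "square_integrable N = {h \<in> borel_measurable N. integrable N (\<lambda>x. (cmod (h x))\<^sup>2)}"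

definition ae_eq :: "'a measure \<Rightarrow> (('a \<Rightarrow> complex) \<times> ('a \<Rightarrow> complex)) set" where
  "ae_eq N = {(h, k). h \<in> square_integrable N \<and> k \<in> square_integrable N \<and> (AE x in N. h x = k x)}"

text \<open>
  Operations on equivalence classes use the idiom of \<^theory>\<open>HOL.Equiv_Relations\<close>: the union over
  all representatives is again a single class precisely because the operation respects
  \<^const>\<open>ae_eq\<close>.
\<close>

definition L2 :: "'a measure \<Rightarrow> ('a \<Rightarrow> complex) set hspace" where
  "L2 N = \<lparr>
     hcarrier = square_integrable N // ae_eq N,
     hzero = ae_eq N `` {\<lambda>x. 0},
     hadd = (\<lambda>c d. \<Union>h\<in>c. \<Union>k\<in>d. ae_eq N `` {\<lambda>x. h x + k x}),
     hscale = (\<lambda>a c. \<Union>h\<in>c. ae_eq N `` {\<lambda>x. a * h x}),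
     hinner = (\<lambda>c d. the_elem (\<Union>h\<in>c. \<Union>k\<in>d. {\<integral>x. cnj (h x) * k x \<partial>N}))\<rparr>"

definition koopman ::
  "'a measure \<Rightarrow> ('a \<Rightarrow> 'a) \<Rightarrow> ('a \<Rightarrow> complex) set \<Rightarrow> ('a \<Rightarrow> complex) set" where
  "koopman N S c = (\<Union>h\<in>c. ae_eq N `` {h \<circ> S})"

end

theory Submission
  imports Defs
begin

text \<open>
  Composition with \<open>\<phi>\<close> is the required unitary operator.  Change of variables makes it isometric,
  composition with the measurable map \<open>\<phi>\<^sup>-\<^sup>1\<close> inverts it, and it intertwines the two Koopman
  operators because \<open>(h \<circ> T') \<circ> \<phi> = (h \<circ> \<phi>) \<circ> T\<close>.
\<close>

section \<open>Square-integrable functions\<close>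

lemma square_integrable_measurable:
  "h \<in> square_integrable N \<Longrightarrow> h \<in> borel_measurable N"
  by (simp add: square_integrable_def)

lemma square_integrable_integrable:
  "h \<in> square_integrable N \<Longrightarrow> integrable N (\<lambda>x. (cmod (h x))\<^sup>2)"
  by (simp add: square_integrable_def)

lemma zero_square_integrable: "(\<lambda>x. 0) \<in> square_integrable N"
  by (simp add: square_integrable_def)

lemma scale_square_integrable:
  "h \<in> square_integrable N \<Longrightarrow> (\<lambda>x. a * h x) \<in> square_integrable N"
  by (auto simp: square_integrable_def norm_mult power_mult_distrib intro!: borel_measurable_times)

lemma add_square_integrable:
  assumes "h \<in> square_integrable N" "k \<in> square_integrable N"
  shows "(\<lambda>x. h x + k x) \<in> square_integrable N"
proof -
  note [measurable] = assms[THEN square_integrable_measurable]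
  \<comment> \<open>The factor 2 absorbs the cross term of the square, since 2ab \<le> a^2 +
    b^2.\<close>
  have bound: "(cmod (h x + k x))\<^sup>2 \<le> 2 * (cmod (h x))\<^sup>2 + 2 * (cmod (k x))\<^sup>2" for x
  proof -
    have "(cmod (h x + k x))\<^sup>2 \<le> (cmod (h x) + cmod (k x))\<^sup>2"
      by (intro power_mono norm_triangle_ineq) auto
    also have "\<dots> \<le> 2 * (cmod (h x))\<^sup>2 + 2 * (cmod (k x))\<^sup>2"
      using sum_squares_bound[of "cmod (h x)" "cmod (k x)"] unfolding power2_sum by linarith
    finally show ?thesis .
  qed
  have "integrable N (\<lambda>x. (cmod (h x + k x))\<^sup>2)"
  proof (rule Bochner_Integration.integrable_bound)
    show "integrable N (\<lambda>x. 2 * (cmod (h x))\<^sup>2 + 2 * (cmod (k x))\<^sup>2)"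
      by (intro Bochner_Integration.integrable_add integrable_mult_right
          assms[THEN square_integrable_integrable])
    show "AE x in N. norm ((cmod (h x + k x))\<^sup>2)
        \<le> norm (2 * (cmod (h x))\<^sup>2 + 2 * (cmod (k x))\<^sup>2)"
      by (intro AE_I2 order.trans[OF _ abs_ge_self, folded real_norm_def]) (simp add: bound)
  qed measurable
  then show ?thesis by (simp add: square_integrable_def)
qed

lemma diff_square_integrable:
  assumes "h \<in> square_integrable N" "k \<in> square_integrable N"
  shows "(\<lambda>x. h x - k x) \<in> square_integrable N"
  using add_square_integrable[OF assms(1) scale_square_integrable[OF assms(2), of "-1"]] by simp

lemma borel_measurable_cnj [measurable (raw)]:
  fixes h :: "'a \<Rightarrow> complex"
  assumes "h \<in> borel_measurable N"
  shows "(\<lambda>x. cnj (h x)) \<in> borel_measurable N"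
  using measurable_comp[OF assms
      borel_measurable_continuous_onI[OF continuous_on_cnj[OF continuous_on_id]]]
  by (simp add: comp_def)

text \<open>The product is dominated by the sum of the two squares. This integrability is what
  licenses additivity of the inner product, since the Bochner integral is additive on integrable
  functions.\<close>

lemma integrable_cnj_mult:
  assumes "h \<in> square_integrable N" "k \<in> square_integrable N"
  shows "integrable N (\<lambda>x. cnj (h x) * k x)"
proof -
  note [measurable] = assms[THEN square_integrable_measurable]
  have bound: "cmod (h x) * cmod (k x) \<le> (cmod (h x))\<^sup>2 + (cmod (k x))\<^sup>2" for x
    using sum_squares_bound[of "cmod (h x)" "cmod (k x)"]
      mult_nonneg_nonneg[OF norm_ge_zero norm_ge_zero, of "h x" "k x"] by linarith
  show ?thesis
  proof (rule Bochner_Integration.integrable_bound)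
    show "integrable N (\<lambda>x. (cmod (h x))\<^sup>2 + (cmod (k x))\<^sup>2)"
      by (intro Bochner_Integration.integrable_add assms[THEN square_integrable_integrable])
    show "AE x in N. norm (cnj (h x) * k x) \<le> norm ((cmod (h x))\<^sup>2 + (cmod (k x))\<^sup>2)"
      by (intro AE_I2 order.trans[OF _ abs_ge_self, folded real_norm_def])
        (simp add: norm_mult bound)
  qed measurable
qed

text \<open>Change of variables. The form \<open>distr N N' S = N'\<close> covers at once a
  measure-preserving self-map and a map into a space carrying the push-forward measure.\<close>

lemma square_integrable_comp:
  assumes S: "S \<in> measurable N N'" and d: "distr N N' S = N'" and h: "h \<in> square_integrable N'"
  shows "h \<circ> S \<in> square_integrable N"
proof -
  note [measurable] = S square_integrable_measurable[OF h]
  have "integrable (distr N N' S) (\<lambda>x. (cmod (h x))\<^sup>2)"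
    using square_integrable_integrable[OF h] by (simp add: d)
  then have "integrable N (\<lambda>x. (cmod (h (S x)))\<^sup>2)"
    by (subst (asm) integrable_distr_eq) auto
  then show ?thesis by (simp add: square_integrable_def comp_def)
qed

text \<open>The weight 4^n splits the decay 8^(-n) in two: the weighted integrals are still
  summable, being at most 2^(-n), and finiteness of the weighted series at a point forces the
  increments there to decay like 2^(-n).\<close>

lemma square_integrable_AE_lim:
  assumes h: "\<And>n. h n \<in> square_integrable N"
    and bound: "\<And>n. (\<integral>x. (cmod (h (Suc n) x - h n x))\<^sup>2 \<partial>N) \<le> (1/8) ^ n"
  shows "AE x in N. convergent (\<lambda>n. h n x)"
proof -
  note [measurable] = square_integrable_measurable[OF h]
  define d where "d n x = (cmod (h (Suc n) x - h n x))\<^sup>2" for n x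
  have d_meas [measurable]: "d n \<in> borel_measurable N" for n
    unfolding d_def by measurable
  have d_int: "integrable N (d n)" for n
    using diff_square_integrable[OF h h, THEN square_integrable_integrable]
    by (simp add: d_def[abs_def])
  have d_nonneg: "0 \<le> d n x" for n x
    by (simp add: d_def)
  have "(\<integral>\<^sup>+x. ennreal (4 ^ n * d n x) \<partial>N) \<le> ennreal ((1/2) ^ n)" for n
  proof -
    have "(\<integral>\<^sup>+x. ennreal (4 ^ n * d n x) \<partial>N) = ennreal (\<integral>x. 4 ^ n * d n x \<partial>N)"
      using d_int d_nonneg by (intro nn_integral_eq_integral) auto
    also have "(\<integral>x. 4 ^ n * d n x \<partial>N) = 4 ^ n * (\<integral>x. d n x \<partial>N)"
      by simp
    also have "\<dots> \<le> 4 ^ n * (1/8) ^ n"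
      using bound[of n] by (simp add: d_def)
    also have "\<dots> = (1/2) ^ n"
      by (simp flip: power_mult_distrib)
    finally show ?thesis by (simp add: ennreal_leI)
  qed
  then have "(\<Sum>n. \<integral>\<^sup>+x. ennreal (4 ^ n * d n x) \<partial>N) \<le> (\<Sum>n. ennreal ((1/2) ^ n))"
    by (intro suminf_le) auto
  also have "\<dots> = ennreal (\<Sum>n. (1/2) ^ n)"
    by (rule suminf_ennreal2) auto
  also have "\<dots> < \<infinity>"
    by simp
  \<comment> \<open>Sum and integral of nonnegative functions are interchanged; a function with
    finite integral is finite almost everywhere.\<close>
  finally have "(\<integral>\<^sup>+x. (\<Sum>n. ennreal (4 ^ n * d n x)) \<partial>N) \<noteq> \<infinity>"
    by (subst nn_integral_suminf) auto
  then have "AE x in N. (\<Sum>n. ennreal (4 ^ n * d n x)) \<noteq> \<infinity>"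
    by (intro nn_integral_PInf_AE) auto
  then show ?thesis
  proof (rule AE_mp, intro AE_I2 impI)
    fix x
    define C where "C = (\<Sum>n. ennreal (4 ^ n * d n x))"
    assume "(\<Sum>n. ennreal (4 ^ n * d n x)) \<noteq> \<infinity>"
    then have C: "C < \<infinity>" by (simp add: C_def less_top)
    have two_four: "(2 ^ n)\<^sup>2 = (4::real) ^ n" for n
      by (simp add: power2_eq_square flip: power_mult_distrib)
    \<comment> \<open>A single term of a nonnegative series is at most its sum. Taking roots then
      turns 4^n into 2^n.\<close>
    have "4 ^ n * d n x \<le> enn2real C" for n
    proof -
      have "ennreal (4 ^ n * d n x) \<le> C"
        unfolding C_def using sum_le_suminf[of "\<lambda>n. ennreal (4 ^ n * d n x)" "{n}"] by auto
      then have "enn2real (ennreal (4 ^ n * d n x)) \<le> enn2real C"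
        using C by (intro enn2real_mono) auto
      then show ?thesis using d_nonneg[of n x] by simp
    qed
    then have "(2 ^ n * cmod (h (Suc n) x - h n x))\<^sup>2 \<le> enn2real C" for n
      by (simp add: d_def power_mult_distrib two_four)
    then have "2 ^ n * cmod (h (Suc n) x - h n x) \<le> sqrt (enn2real C)" for n
      by (rule real_le_rsqrt)
    then have le: "cmod (h (Suc n) x - h n x) \<le> sqrt (enn2real C) * (1/2) ^ n" for n
      by (simp add: field_simps power_one_over)
    have "summable (\<lambda>n. h (Suc n) x - h n x)"
      by (rule summable_comparison_test'[OF _ le]) (intro summable_mult summable_geometric, simp)
    \<comment> \<open>These partial sums telescope to \<open>h n x - h 0 x\<close>.\<close>
    then have "convergent (\<lambda>n. \<Sum>i<n. h (Suc i) x - h i x)"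
      by (simp add: summable_iff_convergent)
    then have "convergent (\<lambda>n. h n x - h 0 x)"
      by (simp only: sum_lessThan_telescope[of "\<lambda>i. h i x"])
    then show "convergent (\<lambda>n. h n x)"
      using convergent_diff_const_right_iff[of "\<lambda>n. h n x" "h 0 x"] by simp
  qed
qed

text \<open>
  Riesz--Fischer: a subsequence whose consecutive distances decay geometrically converges almost
  everywhere, and Fatou's lemma turns its pointwise limit into the limit in mean square.
\<close>

lemma square_integrable_complete:
  assumes h: "\<And>n. h n \<in> square_integrable N"
    and cauchy: "\<And>e. e > 0 \<Longrightarrow>
      \<exists>n0. \<forall>i\<ge>n0. \<forall>j\<ge>n0. (\<integral>x. (cmod (h i x - h j x))\<^sup>2 \<partial>N) < e"
  shows "\<exists>l\<in>square_integrable N. (\<lambda>n. \<integral>x. (cmod (h n x - l x))\<^sup>2 \<partial>N) \<longlonglongrightarrow> 0"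
proof -
  note [measurable] = square_integrable_measurable[OF h]
  have "\<exists>k. \<forall>i\<ge>k. \<forall>j\<ge>k. (\<integral>x. (cmod (h i x - h j x))\<^sup>2 \<partial>N) < (1/8) ^ n" for n
    by (rule cauchy) simp
  then obtain q where
    q: "\<And>n i j. i \<ge> q n \<Longrightarrow> j \<ge> q n \<Longrightarrow> (\<integral>x. (cmod (h i x - h j x))\<^sup>2 \<partial>N) < (1/8) ^ n"
    by metis
  \<comment> \<open>The thresholds \<open>q\<close> may fail to be monotone; their running sum is
    monotone and dominates each of them. The summand \<open>n\<close> makes the indices tend to
    infinity.\<close>
  define r where "r n = n + (\<Sum>i\<le>n. q i)" for n
  have r_ge: "r n \<ge> n" "r n \<ge> q n" for n
    using member_le_sum[of n "{..n}" q] by (auto simp: r_def)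
  have r_mono: "r n \<le> r (Suc n)" for n
    by (simp add: r_def)
  \<comment> \<open>\<open>lim\<close> takes one fixed value on all divergent sequences, so
    \<open>l\<close> is defined and measurable on the whole space.\<close>
  define l where "l x = lim (\<lambda>n. h (r n) x)" for x
  have [measurable]: "l \<in> borel_measurable N"
    unfolding l_def by measurable
  have "(\<integral>x. (cmod (h (r (Suc n)) x - h (r n) x))\<^sup>2 \<partial>N) \<le> (1/8) ^ n" for n
    by (intro less_imp_le q order.trans[OF r_ge(2) r_mono] r_ge)
  then have "AE x in N. convergent (\<lambda>n. h (r n) x)"
    by (intro square_integrable_AE_lim h)
  then have lim: "AE x in N. (\<lambda>n. h (r n) x) \<longlonglongrightarrow> l x"
    by eventually_elim (simp add: l_def convergent_LIMSEQ_iff)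
  \<comment> \<open>The nonnegative integral is used because integrability of the difference is
    still open; the bound will supply it. The threshold stays general: it serves with 1 for
    membership of \<open>l\<close>, and with \<open>e / 2\<close> for convergence.\<close>
  have fatou: "(\<integral>\<^sup>+x. ennreal ((cmod (h n x - l x))\<^sup>2) \<partial>N) \<le> ennreal e"
    if n0: "\<And>i j. i \<ge> n0 \<Longrightarrow> j \<ge> n0 \<Longrightarrow> (\<integral>x. (cmod (h i x - h j x))\<^sup>2 \<partial>N) < e" and "n \<ge> n0"
    for n n0 e
  proof -
    have "(\<integral>\<^sup>+x. ennreal ((cmod (h n x - l x))\<^sup>2) \<partial>N)
      = (\<integral>\<^sup>+x. liminf (\<lambda>j. ennreal ((cmod (h n x - h (r j) x))\<^sup>2)) \<partial>N)"
    proof (rule nn_integral_cong_AE, use lim in eventually_elim)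
      case (elim x)
      then have "(\<lambda>j. ennreal ((cmod (h n x - h (r j) x))\<^sup>2)) \<longlonglongrightarrow> ennreal ((cmod (h n x - l x))\<^sup>2)"
        by (intro tendsto_intros)
      then show ?case
        by (intro lim_imp_Liminf[symmetric]) auto
    qed
    also have "\<dots> \<le> liminf (\<lambda>j. \<integral>\<^sup>+x. ennreal ((cmod (h n x - h (r j) x))\<^sup>2) \<partial>N)"
      by (rule nn_integral_liminf) measurable
    also have "\<dots> = liminf (\<lambda>j. ennreal (\<integral>x. (cmod (h n x - h (r j) x))\<^sup>2 \<partial>N))"
      by (subst nn_integral_eq_integral)
        (auto intro!: square_integrable_integrable diff_square_integrable h)
    also have "\<dots> \<le> liminf (\<lambda>j. ennreal e)"
    proof (rule Liminf_mono)
      \<comment> \<open>Since \<open>r j \<ge> j\<close>, every \<open>j \<ge> n0\<close> yields an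
        index \<open>r j\<close> in the range of the Cauchy estimate.\<close>
      show "\<forall>\<^sub>F j in sequentially. ennreal (\<integral>x. (cmod (h n x - h (r j) x))\<^sup>2 \<partial>N) \<le> ennreal e"
        using eventually_ge_at_top[of n0]
      proof eventually_elim
        case (elim j)
        then show ?case
          using n0[OF \<open>n \<ge> n0\<close> order.trans[OF elim r_ge(1)]] by (intro ennreal_leI) simp
      qed
    qed
    also have "\<dots> = ennreal e"
      by (simp add: Liminf_const)
    finally show ?thesis .
  qed
  have diff: "integrable N (\<lambda>x. (cmod (h n x - l x))\<^sup>2)"
    if n0: "\<And>i j. i \<ge> n0 \<Longrightarrow> j \<ge> n0 \<Longrightarrow> (\<integral>x. (cmod (h i x - h j x))\<^sup>2 \<partial>N) < e" and "n \<ge> n0"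
    for n n0 e
  proof (rule integrableI_bounded)
    have "(\<integral>\<^sup>+x. ennreal (norm ((cmod (h n x - l x))\<^sup>2)) \<partial>N) \<le> ennreal e"
      using fatou[of n0 e n, OF n0 \<open>n \<ge> n0\<close>] by simp
    also have "\<dots> < \<infinity>"
      by simp
    finally show "(\<integral>\<^sup>+x. ennreal (norm ((cmod (h n x - l x))\<^sup>2)) \<partial>N) < \<infinity>" .
  qed measurable
  obtain n1 where n1: "\<And>i j. i \<ge> n1 \<Longrightarrow> j \<ge> n1 \<Longrightarrow> (\<integral>x. (cmod (h i x - h j x))\<^sup>2 \<partial>N) < 1"
    using cauchy[of 1] by auto
  \<comment> \<open>One index at finite distance suffices, because \<open>l\<close> is
    \<open>h n1\<close> minus this difference.\<close>
  have "(\<lambda>x. h n1 x - l x) \<in> square_integrable N"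
    using diff[of n1 1, OF n1] by (simp add: square_integrable_def)
  from diff_square_integrable[OF h[of n1] this] have l: "l \<in> square_integrable N"
    by simp
  have "(\<lambda>n. \<integral>x. (cmod (h n x - l x))\<^sup>2 \<partial>N) \<longlonglongrightarrow> 0"
  proof (rule LIMSEQ_I)
    fix e :: real assume "e > 0"
    \<comment> \<open>Passing to the limit leaves only a weak inequality, hence the half.\<close>
    then obtain n0 where
      n0: "\<And>i j. i \<ge> n0 \<Longrightarrow> j \<ge> n0 \<Longrightarrow> (\<integral>x. (cmod (h i x - h j x))\<^sup>2 \<partial>N) < e / 2"
      using cauchy[of "e / 2"] by auto
    have "norm ((\<integral>x. (cmod (h n x - l x))\<^sup>2 \<partial>N) - 0) < e" if "n \<ge> n0" for n
    proof -
      have "ennreal (\<integral>x. (cmod (h n x - l x))\<^sup>2 \<partial>N) \<le> ennreal (e / 2)"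
        using fatou[of n0 "e / 2" n, OF n0 that]
        by (subst nn_integral_eq_integral[symmetric])
          (auto intro!: square_integrable_integrable diff_square_integrable h l)
      then have "(\<integral>x. (cmod (h n x - l x))\<^sup>2 \<partial>N) \<le> e / 2"
        using \<open>e > 0\<close> by (subst (asm) ennreal_le_iff) auto
      then show ?thesis using \<open>e > 0\<close> by simp
    qed
    then show "\<exists>n0. \<forall>n\<ge>n0. norm ((\<integral>x. (cmod (h n x - l x))\<^sup>2 \<partial>N) - 0) < e" by blast
  qed
  with l show ?thesis by blast
qed

section \<open>The Hilbert space of equivalence classes\<close>

abbreviation L2_class :: "'a measure \<Rightarrow> ('a \<Rightarrow> complex) \<Rightarrow> ('a \<Rightarrow> complex) set" where
  "L2_class N h \<equiv> ae_eq N `` {h}"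

lemma equiv_ae_eq: "equiv (square_integrable N) (ae_eq N)"
proof (rule equivI)
  show "ae_eq N \<subseteq> square_integrable N \<times> square_integrable N"
    by (auto simp: ae_eq_def)
  show "refl_on (square_integrable N) (ae_eq N)"
    by (simp add: refl_on_def ae_eq_def)
  show "sym (ae_eq N)"
    by (simp add: sym_def ae_eq_def eq_commute)
  show "trans (ae_eq N)"
  proof (rule transI)
    fix h k g assume hk: "(h, k) \<in> ae_eq N" and kg: "(k, g) \<in> ae_eq N"
    then have "AE x in N. h x = k x" "AE x in N. k x = g x"
      by (simp_all add: ae_eq_def)
    then have "AE x in N. h x = g x"
      by eventually_elim simp
    with hk kg show "(h, g) \<in> ae_eq N"
      by (simp add: ae_eq_def)
  qed
qed

section \<open>Passing between classes and representatives\<close>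

lemma L2_carrier_iff: "c \<in> hcarrier (L2 N) \<longleftrightarrow> (\<exists>h\<in>square_integrable N. c = L2_class N h)"
  by (auto simp: L2_def quotient_def)

lemma L2_class_in_carrier: "h \<in> square_integrable N \<Longrightarrow> L2_class N h \<in> hcarrier (L2 N)"
  by (auto simp: L2_carrier_iff)

lemma L2_carrierE:
  assumes "c \<in> hcarrier (L2 N)"
  obtains h where "h \<in> square_integrable N" "c = L2_class N h"
  using assms by (auto simp: L2_carrier_iff)

lemma L2_class_eqI:
  assumes "h \<in> square_integrable N" "k \<in> square_integrable N" "AE x in N. h x = k x"
  shows "L2_class N h = L2_class N k"
  using assms by (intro equiv_class_eq[OF equiv_ae_eq]) (simp add: ae_eq_def)

lemma L2_class_memD:
  assumes "k \<in> L2_class N h"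
  shows "k \<in> square_integrable N" "AE x in N. h x = k x"
  using assms by (auto simp: ae_eq_def)

lemma L2_class_self: "h \<in> square_integrable N \<Longrightarrow> h \<in> L2_class N h"
  by (auto simp: ae_eq_def)

lemma L2_zero: "hzero (L2 N) = L2_class N (\<lambda>x. 0)"
  by (simp add: L2_def)

text \<open>Every choice of representatives contributes the same class, so the union in
  \<open>L2\<close> is constant. It collapses to that class because the index sets are nonempty, by
  \<open>L2_class_self\<close>. Scaling and the inner product follow the same pattern.\<close>

lemma L2_add_class:
  assumes "h \<in> square_integrable N" "k \<in> square_integrable N"
  shows "hadd (L2 N) (L2_class N h) (L2_class N k) = L2_class N (\<lambda>x. h x + k x)"
proof -
  have "L2_class N (\<lambda>x. h' x + k' x) = L2_class N (\<lambda>x. h x + k x)"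
    if h': "h' \<in> L2_class N h" and k': "k' \<in> L2_class N k" for h' k'
  proof (intro L2_class_eqI add_square_integrable L2_class_memD(1)[OF h']
      L2_class_memD(1)[OF k'] assms)
    show "AE x in N. h' x + k' x = h x + k x"
      using L2_class_memD(2)[OF h'] L2_class_memD(2)[OF k'] by eventually_elim simp
  qed
  then have "(\<Union>h'\<in>L2_class N h. \<Union>k'\<in>L2_class N k. L2_class N (\<lambda>x. h' x + k' x))
    = (\<Union>h'\<in>L2_class N h. \<Union>k'\<in>L2_class N k. L2_class N (\<lambda>x. h x + k x))"
    by (intro SUP_cong refl)
  also have "\<dots> = L2_class N (\<lambda>x. h x + k x)"
    using L2_class_self[OF assms(1)] L2_class_self[OF assms(2)] by blast
  finally show ?thesis by (simp add: L2_def)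
qed

lemma L2_scale_class:
  assumes "h \<in> square_integrable N"
  shows "hscale (L2 N) a (L2_class N h) = L2_class N (\<lambda>x. a * h x)"
proof -
  have "L2_class N (\<lambda>x. a * h' x) = L2_class N (\<lambda>x. a * h x)" if "h' \<in> L2_class N h" for h'
  proof (intro L2_class_eqI scale_square_integrable L2_class_memD(1)[OF that] assms)
    show "AE x in N. a * h' x = a * h x"
      using L2_class_memD(2)[OF that] by eventually_elim simp
  qed
  then have "(\<Union>h'\<in>L2_class N h. L2_class N (\<lambda>x. a * h' x))
    = (\<Union>h'\<in>L2_class N h. L2_class N (\<lambda>x. a * h x))"
    by (intro SUP_cong refl)
  also have "\<dots> = L2_class N (\<lambda>x. a * h x)"
    using L2_class_self[OF assms] by blast
  finally show ?thesis by (simp add: L2_def)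
qed

lemma L2_inner_class:
  assumes "h \<in> square_integrable N" "k \<in> square_integrable N"
  shows "hinner (L2 N) (L2_class N h) (L2_class N k) = (\<integral>x. cnj (h x) * k x \<partial>N)"
proof -
  have "(\<integral>x. cnj (h' x) * k' x \<partial>N) = (\<integral>x. cnj (h x) * k x \<partial>N)"
    if "h' \<in> L2_class N h" "k' \<in> L2_class N k" for h' k'
  proof -
    note [measurable] = assms[THEN square_integrable_measurable]
      L2_class_memD(1)[OF that(1), THEN square_integrable_measurable]
      L2_class_memD(1)[OF that(2), THEN square_integrable_measurable]
    show ?thesis
    proof (rule integral_cong_AE)
      show "AE x in N. cnj (h' x) * k' x = cnj (h x) * k x"
        using L2_class_memD(2)[OF that(1)] L2_class_memD(2)[OF that(2)] by eventually_elim simp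
    qed measurable
  qed
  then have "(\<Union>h'\<in>L2_class N h. \<Union>k'\<in>L2_class N k. {\<integral>x. cnj (h' x) * k' x \<partial>N})
    = (\<Union>h'\<in>L2_class N h. \<Union>k'\<in>L2_class N k. {\<integral>x. cnj (h x) * k x \<partial>N})"
    by (intro SUP_cong refl) simp
  also have "\<dots> = {\<integral>x. cnj (h x) * k x \<partial>N}"
    using L2_class_self[OF assms(1)] L2_class_self[OF assms(2)] by blast
  finally show ?thesis by (simp add: L2_def)
qed

lemma L2_inner_self:
  assumes "h \<in> square_integrable N"
  shows "hinner (L2 N) (L2_class N h) (L2_class N h) = complex_of_real (\<integral>x. (cmod (h x))\<^sup>2 \<partial>N)"
proof -
  have "cnj z * z = complex_of_real ((cmod z)\<^sup>2)" for z
    by (simp only: complex_norm_square mult.commute)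
  then show ?thesis
    by (simp only: L2_inner_class[OF assms assms] integral_complex_of_real)
qed

lemma L2_dist_class:
  assumes "h \<in> square_integrable N" "k \<in> square_integrable N"
  shows "hdist (L2 N) (L2_class N h) (L2_class N k) = sqrt (\<integral>x. (cmod (h x - k x))\<^sup>2 \<partial>N)"
proof -
  have "hadd (L2 N) (L2_class N h) (hscale (L2 N) (-1) (L2_class N k)) = L2_class N (\<lambda>x. h x - k x)"
    using L2_add_class[OF assms(1) scale_square_integrable[OF assms(2), of "-1"]]
    by (simp add: L2_scale_class[OF assms(2)])
  then show ?thesis
    by (simp add: hdist_def hnorm_def L2_inner_self[OF diff_square_integrable[OF assms]])
qed

text \<open>Choosing a representative of each class reduces this to
  \<open>square_integrable_complete\<close>.\<close>

lemma L2_complete: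
  assumes s: "\<And>n. s n \<in> hcarrier (L2 N)"
    and cauchy: "\<forall>e>0. \<exists>n0. \<forall>i\<ge>n0. \<forall>j\<ge>n0. hdist (L2 N) (s i) (s j) < e"
  shows "\<exists>l\<in>hcarrier (L2 N). (\<lambda>n. hdist (L2 N) (s n) l) \<longlonglongrightarrow> 0"
proof -
  obtain h where h: "\<And>n. h n \<in> square_integrable N" and s_eq: "\<And>n. s n = L2_class N (h n)"
    using s unfolding L2_carrier_iff by metis
  have dist: "hdist (L2 N) (s i) (s j) = sqrt (\<integral>x. (cmod (h i x - h j x))\<^sup>2 \<partial>N)" for i j
    by (simp add: s_eq L2_dist_class h)
  have "\<exists>n0. \<forall>i\<ge>n0. \<forall>j\<ge>n0. (\<integral>x. (cmod (h i x - h j x))\<^sup>2 \<partial>N) < e" if "e > 0" for e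
  proof -
    \<comment> \<open>\<open>hdist\<close> is the root of the mean-square integral, so the threshold
      \<open>e\<close> for integrals corresponds to \<open>sqrt e\<close> for distances.\<close>
    from that have "sqrt e > 0"
      by simp
    with cauchy have "\<exists>n0. \<forall>i\<ge>n0. \<forall>j\<ge>n0. hdist (L2 N) (s i) (s j) < sqrt e"
      by blast
    then show ?thesis
      by (simp only: dist real_sqrt_less_iff)
  qed
  from square_integrable_complete[OF h this] obtain l where l: "l \<in> square_integrable N"
    "(\<lambda>n. \<integral>x. (cmod (h n x - l x))\<^sup>2 \<partial>N) \<longlonglongrightarrow> 0"
    by (rule bexE)
  have "(\<lambda>n. hdist (L2 N) (s n) (L2_class N l)) \<longlonglongrightarrow> 0"
    using tendsto_real_sqrt[OF l(2)] by (simp add: s_eq L2_dist_class h l)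
  then show ?thesis using L2_class_in_carrier[OF l(1)] by blast
qed

lemma hilbert_space_L2: "hilbert_space (L2 N)"
proof
  note closed = zero_square_integrable add_square_integrable scale_square_integrable
  note ops = L2_zero L2_add_class L2_scale_class L2_inner_class closed
  show "hzero (L2 N) \<in> hcarrier (L2 N)"
    by (simp add: L2_zero L2_class_in_carrier closed)
  fix x y z and a b :: complex
  assume x: "x \<in> hcarrier (L2 N)"
  then obtain h where h: "h \<in> square_integrable N" "x = L2_class N h" by (rule L2_carrierE)
  show "hscale (L2 N) a x \<in> hcarrier (L2 N)"
    using h by (simp add: ops L2_class_in_carrier)
  show "hadd (L2 N) x (hzero (L2 N)) = x"
    using h by (simp add: ops)
  show "hadd (L2 N) x (hscale (L2 N) (-1) x) = hzero (L2 N)"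
    using h scale_square_integrable[OF h(1), of "-1"] by (simp add: ops)
  show "hscale (L2 N) (a + b) x = hadd (L2 N) (hscale (L2 N) a x) (hscale (L2 N) b x)"
    using h by (simp add: ops distrib_right)
  show "hscale (L2 N) a (hscale (L2 N) b x) = hscale (L2 N) (a * b) x"
    using h by (simp add: ops mult.assoc)
  show "hscale (L2 N) 1 x = x"
    using h by (simp add: ops)
  show "0 \<le> Re (hinner (L2 N) x x)"
    using h by (simp add: L2_inner_self)
  \<comment> \<open>Definiteness depends on the quotient: a vanishing integral gives
    \<open>h x = 0\<close> only almost everywhere.\<close>
  show "x = hzero (L2 N)" if "hinner (L2 N) x x = 0"
  proof -
    have "(\<integral>x. (cmod (h x))\<^sup>2 \<partial>N) = 0"
      using that h by (simp add: L2_inner_self)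
    then have "AE x in N. (cmod (h x))\<^sup>2 = 0"
      using square_integrable_integrable[OF h(1)]
      by (subst (asm) integral_nonneg_eq_0_iff_AE) auto
    then show ?thesis
      unfolding L2_zero h(2) by (intro L2_class_eqI h closed) auto
  qed
  assume y: "y \<in> hcarrier (L2 N)"
  then obtain k where k: "k \<in> square_integrable N" "y = L2_class N k" by (rule L2_carrierE)
  show "hadd (L2 N) x y \<in> hcarrier (L2 N)"
    using h k by (simp add: ops L2_class_in_carrier)
  show "hadd (L2 N) x y = hadd (L2 N) y x"
    using h k by (simp add: ops add.commute)
  show "hscale (L2 N) a (hadd (L2 N) x y) = hadd (L2 N) (hscale (L2 N) a x) (hscale (L2 N) a y)"
    using h k by (simp add: ops distrib_left)
  show "hinner (L2 N) x y = cnj (hinner (L2 N) y x)"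
  proof -
    have "cnj (\<integral>t. cnj (k t) * h t \<partial>N) = (\<integral>t. cnj (cnj (k t) * h t) \<partial>N)"
      by (rule Bochner_Integration.integral_cnj[symmetric])
    then show ?thesis
      using h k by (simp add: ops mult.commute)
  qed
  show "hinner (L2 N) x (hscale (L2 N) a y) = a * hinner (L2 N) x y"
    using h k by (simp add: ops mult.left_commute)
  assume z: "z \<in> hcarrier (L2 N)"
  then obtain g where g: "g \<in> square_integrable N" "z = L2_class N g" by (rule L2_carrierE)
  show "hadd (L2 N) (hadd (L2 N) x y) z = hadd (L2 N) x (hadd (L2 N) y z)"
    using h k g by (simp add: ops add.assoc)
  show "hinner (L2 N) x (hadd (L2 N) y z) = hinner (L2 N) x y + hinner (L2 N) x z"
    using h k g by (simp add: ops distrib_left integrable_cnj_mult)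
qed (rule L2_complete)

section \<open>Composition operators\<close>

text \<open>Source and target types may differ, so the same operator describes composition with
  \<open>\<phi>\<close> as well as the Koopman operators.\<close>

definition pullback ::
  "'a measure \<Rightarrow> ('a \<Rightarrow> 'b) \<Rightarrow> ('b \<Rightarrow> complex) set \<Rightarrow> ('a \<Rightarrow> complex) set" where
  "pullback N S c = (\<Union>h\<in>c. L2_class N (h \<circ> S))"

lemma koopman_eq_pullback: "koopman N S = pullback N S"
  by (simp add: fun_eq_iff koopman_def pullback_def)

text \<open>Preimages of \<open>N'\<close>-null sets are \<open>N\<close>-null because
  \<open>N'\<close> is the image measure. Composition therefore respects almost-everywhere
  equality.\<close>

lemma pullback_class:
  assumes S: "S \<in> measurable N N'" and d: "distr N N' S = N'" and h: "h \<in> square_integrable N'"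
  shows "pullback N S (L2_class N' h) = L2_class N (h \<circ> S)"
proof -
  have "L2_class N (h' \<circ> S) = L2_class N (h \<circ> S)" if "h' \<in> L2_class N' h" for h'
  proof (intro L2_class_eqI square_integrable_comp[OF S d] h L2_class_memD(1)[OF that])
    have "AE y in distr N N' S. h y = h' y"
      unfolding d using L2_class_memD(2)[OF that] .
    from AE_distrD[OF S this] show "AE x in N. (h' \<circ> S) x = (h \<circ> S) x"
      by auto
  qed
  then have "pullback N S (L2_class N' h) = (\<Union>h'\<in>L2_class N' h. L2_class N (h \<circ> S))"
    unfolding pullback_def by (intro SUP_cong refl)
  then show ?thesis
    using L2_class_self[OF h] by blast
qed

lemma linear_operator_pullback:
  assumes "S \<in> measurable N N'" "distr N N' S = N'"
  shows "linear_operator (L2 N') (L2 N) (pullback N S)"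
  unfolding linear_operator_def
proof (intro conjI allI ballI)
  fix x assume "x \<in> hcarrier (L2 N')"
  then obtain h where h: "h \<in> square_integrable N'" "x = L2_class N' h"
    by (rule L2_carrierE)
  note hS = square_integrable_comp[OF assms h(1)]
  show "pullback N S x \<in> hcarrier (L2 N)"
    by (simp only: h(2) pullback_class[OF assms h(1)] L2_class_in_carrier[OF hS])
  show "pullback N S (hscale (L2 N') a x) = hscale (L2 N) a (pullback N S x)" for a
  proof -
    have "pullback N S (hscale (L2 N') a x) = L2_class N ((\<lambda>x. a * h x) \<circ> S)"
      by (simp only: h(2) L2_scale_class[OF h(1)]
          pullback_class[OF assms scale_square_integrable[OF h(1)]])
    also have "\<dots> = hscale (L2 N) a (pullback N S x)"
      unfolding h(2) pullback_class[OF assms h(1)] L2_scale_class[OF hS] by (simp only: comp_def)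
    finally show ?thesis .
  qed
  fix y assume "y \<in> hcarrier (L2 N')"
  then obtain k where k: "k \<in> square_integrable N'" "y = L2_class N' k"
    by (rule L2_carrierE)
  note kS = square_integrable_comp[OF assms k(1)]
  have "pullback N S (hadd (L2 N') x y) = L2_class N ((\<lambda>x. h x + k x) \<circ> S)"
    by (simp only: h(2) k(2) L2_add_class[OF h(1) k(1)]
        pullback_class[OF assms add_square_integrable[OF h(1) k(1)]])
  also have "\<dots> = hadd (L2 N) (pullback N S x) (pullback N S y)"
    unfolding h(2) k(2) pullback_class[OF assms h(1)] pullback_class[OF assms k(1)]
      L2_add_class[OF hS kS] by (simp only: comp_def)
  finally show "pullback N S (hadd (L2 N') x y) = hadd (L2 N) (pullback N S x) (pullback N S y)" .
qed

text \<open>Change of variables in the integral. It yields both the isometry of the unitary operator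
  and the boundedness of the Koopman operators.\<close>

lemma inner_pullback:
  assumes S: "S \<in> measurable N N'" and d: "distr N N' S = N'"
    and "c \<in> hcarrier (L2 N')" "c' \<in> hcarrier (L2 N')"
  shows "hinner (L2 N) (pullback N S c) (pullback N S c') = hinner (L2 N') c c'"
proof -
  from assms(3) obtain h where h: "h \<in> square_integrable N'" "c = L2_class N' h"
    by (rule L2_carrierE)
  from assms(4) obtain k where k: "k \<in> square_integrable N'" "c' = L2_class N' k"
    by (rule L2_carrierE)
  note [measurable] = h(1)[THEN square_integrable_measurable] k(1)[THEN square_integrable_measurable]
  have "(\<integral>x. cnj (h (S x)) * k (S x) \<partial>N) = (\<integral>y. cnj (h y) * k y \<partial>distr N N' S)"
    by (rule integral_distr[OF S, symmetric]) measurable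
  then show ?thesis
    using h k by (simp add: d pullback_class[OF S d] L2_inner_class square_integrable_comp[OF S d])
qed

lemma bounded_operator_koopman:
  assumes "S \<in> measurable N N" "distr N N S = N"
  shows "bounded_operator (L2 N) (koopman N S)"
  unfolding bounded_operator_def koopman_eq_pullback hnorm_def
\<comment> \<open>The bound 1 comes from isometry.\<close>
proof (intro conjI exI[of _ 1] ballI)
  show "linear_operator (L2 N) (L2 N) (pullback N S)"
    using assms by (rule linear_operator_pullback)
  show "sqrt (Re (hinner (L2 N) (pullback N S x) (pullback N S x)))
      \<le> 1 * sqrt (Re (hinner (L2 N) x x))" if "x \<in> hcarrier (L2 N)" for x
    by (simp only: inner_pullback[OF assms that that] mult_1 order_refl)
qed

text \<open>Pullback reverses composition, so a left inverse \<open>R\<close> of \<open>S\<close>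
  gives a right inverse of the pullback: the class of \<open>h\<close> is the image of the class of
  \<open>h \<circ> R\<close>.\<close>

lemma unitary_pullback:
  assumes S: "S \<in> measurable N N'" and d: "distr N N' S = N'"
    and R: "R \<in> measurable N' N" and RS: "\<And>x. x \<in> space N \<Longrightarrow> R (S x) = x"
  shows "unitary_operator (L2 N') (L2 N) (pullback N S)"
proof -
  have lin: "linear_operator (L2 N') (L2 N) (pullback N S)"
    using S d by (rule linear_operator_pullback)
  \<comment> \<open>\<open>R\<close> carries the image measure back to \<open>N\<close>, which makes
    \<open>h \<circ> R\<close> square-integrable.\<close>
  have "distr N' N R = distr (distr N N' S) N R"
    by (simp add: d)
  also have "\<dots> = distr N N (R \<circ> S)"
    using R S by (rule distr_distr)
  also have "\<dots> = distr N N (\<lambda>x. x)"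
    by (rule distr_cong) (auto simp: RS)
  also have "\<dots> = N"
    by simp
  finally have dR: "distr N' N R = N" .
  have "c \<in> pullback N S ` hcarrier (L2 N')" if "c \<in> hcarrier (L2 N)" for c
  proof -
    from that obtain h where h: "h \<in> square_integrable N" "c = L2_class N h"
      by (rule L2_carrierE)
    have hR: "h \<circ> R \<in> square_integrable N'"
      using R dR h(1) by (rule square_integrable_comp)
    have "L2_class N (h \<circ> R \<circ> S) = L2_class N h"
      by (intro L2_class_eqI square_integrable_comp[OF S d] hR h AE_I2) (simp add: RS)
    then have "pullback N S (L2_class N' (h \<circ> R)) = c"
      by (simp add: pullback_class[OF S d hR] h(2))
    then show ?thesis
      using L2_class_in_carrier[OF hR] by blast
  qed
  moreover have "pullback N S c \<in> hcarrier (L2 N)" if "c \<in> hcarrier (L2 N')" for c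
    using lin that by (simp add: linear_operator_def)
  ultimately have "pullback N S ` hcarrier (L2 N') = hcarrier (L2 N)"
    by blast
  with lin inner_pullback[OF S d] show ?thesis
    by (simp add: unitary_operator_def)
qed

text \<open>A commuting square of measure-preserving maps gives a commuting square of pullbacks in
  the opposite direction. The square of interest is
  \<open>\<phi> \<circ> T = T' \<circ> \<phi>\<close>.\<close>

lemma pullback_commute:
  assumes S: "S \<in> measurable N N'" "distr N N' S = N'"
    and R: "R \<in> measurable N' N''" "distr N' N'' R = N''"
    and S': "S' \<in> measurable N K" "distr N K S' = K"
    and R': "R' \<in> measurable K N''" "distr K N'' R' = N''"
    and comm: "\<And>x. x \<in> space N \<Longrightarrow> R' (S' x) = R (S x)"
    and c: "c \<in> hcarrier (L2 N'')"
  shows "pullback N S (pullback N' R c) = pullback N S' (pullback K R' c)"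
proof -
  from c obtain h where h: "h \<in> square_integrable N''" "c = L2_class N'' h"
    by (rule L2_carrierE)
  have "L2_class N (h \<circ> R \<circ> S) = L2_class N (h \<circ> R' \<circ> S')"
    by (intro L2_class_eqI square_integrable_comp[OF S] square_integrable_comp[OF R]
        square_integrable_comp[OF S'] square_integrable_comp[OF R'] h AE_I2) (simp add: comm)
  then show ?thesis
    by (simp add: h pullback_class[OF S] pullback_class[OF R] pullback_class[OF S']
        pullback_class[OF R'] square_integrable_comp[OF R] square_integrable_comp[OF R'])
qed

section \<open>Spectral equivalence\<close>

text \<open>Prescribing only the sigma-algebras lets the lemma apply to \<open>\<mu>\<close> and to
  its push-forward alike.\<close>

lemma measurable_continuous_on_subspace:
  fixes F :: "'a::topological_space \<Rightarrow> 'b::topological_space"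
  assumes "sets N = sets (restrict_space borel A)" "sets K = sets (restrict_space borel B)"
    and "continuous_on A F" "F ` A \<subseteq> B"
  shows "F \<in> measurable N K"
proof -
  have "F \<in> measurable (restrict_space borel A) (restrict_space borel B)"
    using assms by (intro measurable_restrict_space2 borel_measurable_continuous_on_restrict)
      (auto simp: space_restrict_space)
  then show ?thesis
    using measurable_cong_sets[OF assms(1,2)] by simp
qed

text \<open>\<open>Euclidean_space n\<close> carries the topology induced by the product topology on
  sequences. On the image the two induced topologies agree, so the abstract embedding acquires a
  continuous inverse for the type-class topology.\<close>

lemma Euclidean_embedding_homeomorphism:
  assumes "embedding_map (top_of_set A) (Euclidean_space n) F"
  shows "\<exists>G. homeomorphism A (F ` A) F G"
proof -
  have hom: "homeomorphic_map (top_of_set A) (subtopology (Euclidean_space n) (F ` A)) F"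
    using assms by (simp add: embedding_map_def)
  have "F ` topspace (top_of_set A) = topspace (Euclidean_space n) \<inter> F ` A"
    using homeomorphic_imp_surjective_map[OF hom] unfolding topspace_subtopology .
  then have sub: "F ` A \<subseteq> {x. \<forall>i\<ge>n. x i = 0}"
    unfolding topspace_Euclidean_space topspace_euclidean_subtopology by blast
  have "subtopology (Euclidean_space n) (F ` A) = top_of_set (F ` A)"
    unfolding Euclidean_space_def euclidean_product_topology subtopology_subtopology
      Int_absorb1[OF sub] ..
  with hom obtain G where "homeomorphic_maps (top_of_set A) (top_of_set (F ` A)) F G"
    unfolding homeomorphic_map_maps by auto
  then have "continuous_on A F" "continuous_on (F ` A) G" "\<forall>x\<in>A. G (F x) = x"
    by (simp_all add: homeomorphic_maps_def continuous_map_in_subtopology)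
  then have "homeomorphism A (F ` A) F G"
    by (simp add: homeomorphism_def image_image)
  then show ?thesis
    by (intro exI[where x = G])
qed

theorem theorem3:
  fixes m :: nat
    and M :: "'a::metric_space set"
    and \<A> :: "'a chart set"
    and \<mu> :: "'a measure"
    and T :: "'a \<Rightarrow> 'a"
    and f :: "'a \<Rightarrow> real"
    and \<phi> :: "'a \<Rightarrow> nat \<Rightarrow> real"
    and T' :: "(nat \<Rightarrow> real) \<Rightarrow> (nat \<Rightarrow> real)"
  assumes "compact_smooth_manifold m M \<A>"
    and "prob_space \<mu>"
    and "sets \<mu> = sets (restrict_space borel M)"
    and "smooth_diffeo m M \<A> T"
    and "distr \<mu> \<mu> T = \<mu>"
    and "smooth_observable m \<A> f"
    and "(\<lambda>x. complex_of_real (f x)) \<in> square_integrable \<mu>"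
    and "\<phi> = delay_map m T f"
    and "smooth_embedding m M \<A> (2 * m + 1) \<phi>"
    and "T' ` (\<phi> ` M) \<subseteq> \<phi> ` M"
    and "\<forall>x\<in>M. \<phi> (T x) = T' (\<phi> x)"
  shows "spectrally_equivalent
           (L2 \<mu>) (koopman \<mu> T)
           (L2 (distr \<mu> (restrict_space borel (\<phi> ` M)) \<phi>))
           (koopman (distr \<mu> (restrict_space borel (\<phi> ` M)) \<phi>) T')"
proof -
  define P where "P = \<phi> ` M"
  define \<nu> where "\<nu> = distr \<mu> (restrict_space borel P) \<phi>"
  have space_\<mu>: "space \<mu> = M"
    using sets_eq_imp_space_eq[OF assms(3)] by (simp add: space_restrict_space)
  have sets_\<nu>: "sets \<nu> = sets (restrict_space borel P)"
    by (simp add: \<nu>_def)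
  have space_\<nu>: "space \<nu> = P"
    by (simp add: \<nu>_def space_restrict_space)
  have T_M: "T ` M \<subseteq> M" and T_cont: "continuous_on M T"
    using assms(4) by (auto simp: smooth_diffeo_def smooth_map_def)
  have emb: "embedding_map (top_of_set M) (Euclidean_space (2 * m + 1)) \<phi>"
    using assms(9) by (simp add: smooth_embedding_def)
  from Euclidean_embedding_homeomorphism[OF this]
  obtain \<psi> where hom: "homeomorphism M P \<phi> \<psi>"
    unfolding P_def by (elim exE)
  have \<phi>_cont: "continuous_on M \<phi>" and \<psi>_cont: "continuous_on P \<psi>"
    and \<psi>_P: "\<psi> ` P = M" and \<psi>\<phi>: "\<And>x. x \<in> M \<Longrightarrow> \<psi> (\<phi> x) = x"
    and \<phi>\<psi>: "\<And>y. y \<in> P \<Longrightarrow> \<phi> (\<psi> y) = y"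
    using hom by (auto simp: homeomorphism_def)
  have meas_T [measurable]: "T \<in> measurable \<mu> \<mu>"
    using measurable_continuous_on_subspace[OF assms(3) assms(3) T_cont T_M] .
  have meas_\<phi> [measurable]: "\<phi> \<in> measurable \<mu> \<nu>"
    using measurable_continuous_on_subspace[OF assms(3) sets_\<nu> \<phi>_cont] by (simp add: P_def)
  have meas_\<psi> [measurable]: "\<psi> \<in> measurable \<nu> \<mu>"
    using measurable_continuous_on_subspace[OF sets_\<nu> assms(3) \<psi>_cont] \<psi>_P by simp
  \<comment> \<open>The conjugacy determines \<open>T'\<close> on \<open>P\<close>, and this formula
    supplies its measurability. Off \<open>P\<close> its values are arbitrary, hence the restriction
    to \<open>space \<nu>\<close>.\<close>
  have T'_eq: "T' y = (\<phi> \<circ> T \<circ> \<psi>) y" if "y \<in> space \<nu>" for y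
    using assms(11) that \<phi>\<psi> \<psi>_P by (force simp: space_\<nu>)
  have meas_T' [measurable]: "T' \<in> measurable \<nu> \<nu>"
    by (subst measurable_cong[OF T'_eq]) auto
  \<comment> \<open>\<open>distr\<close> depends on its target only through the sigma-algebra, and
    \<open>\<nu>\<close> shares that of \<open>restrict_space borel P\<close>.\<close>
  have distr_\<phi>: "distr \<mu> \<nu> \<phi> = \<nu>"
    unfolding \<nu>_def by (rule distr_cong) auto
  have conj: "\<phi> (T x) = T' (\<phi> x)" if "x \<in> space \<mu>" for x
    using assms(11) that by (simp add: space_\<mu>)
  \<comment> \<open>Invariance of \<open>\<nu>\<close> is invariance of \<open>\<mu>\<close>
    transported along the conjugacy.\<close>
  have distr_T': "distr \<nu> \<nu> T' = \<nu>"
  proof -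
    have "distr \<nu> \<nu> T' = distr (distr \<mu> \<nu> \<phi>) \<nu> T'" by (simp add: distr_\<phi>)
    also have "\<dots> = distr \<mu> \<nu> (T' \<circ> \<phi>)" by (rule distr_distr) auto
    also have "\<dots> = distr \<mu> \<nu> (\<phi> \<circ> T)" by (rule distr_cong) (auto simp: conj)
    also have "\<dots> = distr (distr \<mu> \<mu> T) \<nu> \<phi>" by (rule distr_distr[symmetric]) auto
    also have "\<dots> = \<nu>" by (simp add: assms(5) distr_\<phi>)
    finally show ?thesis .
  qed
  have unitary: "unitary_operator (L2 \<nu>) (L2 \<mu>) (pullback \<mu> \<phi>)"
    by (rule unitary_pullback[OF meas_\<phi> distr_\<phi> meas_\<psi>]) (simp add: \<psi>\<phi> space_\<mu>)
  have "pullback \<mu> \<phi> (koopman \<nu> T' c) = koopman \<mu> T (pullback \<mu> \<phi> c)"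
    if "c \<in> hcarrier (L2 \<nu>)" for c
    unfolding koopman_eq_pullback
    using conj that
    by (rule pullback_commute[OF meas_\<phi> distr_\<phi> meas_T' distr_T' meas_T assms(5) meas_\<phi> distr_\<phi>])
  with unitary have
    "\<exists>W. unitary_operator (L2 \<nu>) (L2 \<mu>) W \<and>
       (\<forall>c\<in>hcarrier (L2 \<nu>). W (koopman \<nu> T' c) = koopman \<mu> T (W c))"
    by blast
  then have "spectrally_equivalent (L2 \<mu>) (koopman \<mu> T) (L2 \<nu>) (koopman \<nu> T')"
    unfolding spectrally_equivalent_def
    by (intro conjI hilbert_space_L2 bounded_operator_koopman[OF meas_T assms(5)]
        bounded_operator_koopman[OF meas_T' distr_T'])
  then show ?thesis
    by (simp only: \<nu>_def P_def)
qed

end
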